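(* If $(u,p)$ is a weak solution of the Euler equations on $D_+\times[0,T]$ then $(u_R,p)$ is a weak solution on $D_-\times[0,T]$, i.e. $$\langle u_R(t),\phi(t)\rangle_{D_-}-\langle u_R(0),\phi(0)\rangle_{D_-}-\int_0^t\langle u_R(\tau),\partial_t\phi(\tau)\rangle_{D_-}d\tau=\int_0^t\langle u_R(\tau)\otimes u_R(\tau):\nabla\phi(\tau)\rangle_{D_-}d\tau-\langle p,\phi\cdot n\rangle_{\partial D_-\times[0,t]}$$ for every $t\in[0,T]$ and every $\phi\in\mathcal{S}_\sigma^T(D_-)$.
   Context: $T>0$ is fixed, $\mathbb{T}=\mathbb{R}/2\pi\mathbb{Z}$, $D_+:=\mathbb{T}^2\times[0,\infty)$, $D_-:=\mathbb{T}^2\times(-\infty,0]$, and $\partial D_+=\partial D_-=\{x_3=0\}$. $n$ is the outward normal of the domain in question: on $\partial D_+$, $\phi\cdot n=-\phi_3$; on $\partial D_-$, $\phi\cdot n=\phi_3$. $\mathcal{S}(\mathbb{T}^2\times\mathbb{R})$ is the set of $C^\infty$ functions $\phi$ with $\sup_x|\partial^\alpha\phi(x)||x_3|^k<\infty$ for all multi-indices $\alpha$ and all $k\ge0$; $\mathcal{S}_\sigma(\mathbb{T}^2\times\mathbb{R})$ is the set of divergence-free vector fields in it. $\mathcal{S}(D_\pm)$ and $\mathcal{S}_\sigma(D_\pm)$ are the sets of restrictions to $D_\pm$ of elements of $\mathcal{S}(\mathbb{T}^2\times\mathbb{R})$ and $\mathcal{S}_\sigma(\mathbb{T}^2\times\mathbb{R})$.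 $H_\sigma(D_\pm)$ is the completion in the norm of $L^2(D_\pm)$ of $\{\phi\in\mathcal{S}(D_\pm):\nabla\cdot\phi=0,\ \phi_3=0\text{ on }\partial D_\pm\}$ (vector-valued $\phi$); equivalently, of the smooth divergence-free fields with compact support in the interior of $D_\pm$. $C_{\rm w}([0,T];H_\sigma(D_\pm))$ is the set of $u:[0,T]\to H_\sigma(D_\pm)$ such that $t\mapsto\langle u(t),\phi\rangle_{D_\pm}$ is continuous for every $\phi\in L^2(D_\pm)$. $\mathcal{S}_\sigma^T(D_\pm):=\{\psi\in C^\infty(D_\pm\times[0,T]):\psi(\cdot,t)\in\mathcal{S}_\sigma(D_\pm)\text{ for every }t\in[0,T]\}$. Notation: $\langle f,g\rangle_{D_\pm}=\int_{D_\pm}f_ig_i\,dx$ and $\langle F:G\rangle_{D_\pm}=\int_{D_\pm}F_{ij}G_{ij}\,dx$ (summation convention); $\langle p,g\rangle_{\partial D_\pm\times[0,t]}$ is the pairing of the boundary distribution $p$ with $g$ over $\{x_3=0\}\times[0,t]$ (for smooth $p$ it is $\int_0^t\int_{\{x_3=0\}}pg\,dS\,d\tau$). Weak solution on $D_+\times[0,T]$: a pair $(u,p)$ with $u\in C_{\rm w}([0,T];H_\sigma(D_+))$ and $p\in\mathcal{D}'(\partial D_+\times[0,T])$ such that $$\langle u(t),\phi(t)\rangle_{D_+}-\langle u(0),\phi(0)\rangle_{D_+}-\int_0^t\langle u(\tau),\partial_t\phi(\tau)\rangle_{D_+}d\tau=\int_0^t\langle u(\tau)\otimes u(\tau):\nabla\phi(\tau)\rangle_{D_+}d\tau-\langle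 p,\phi\cdot n\rangle_{\partial D_+\times[0,t]}$$ for every $t\in[0,T]$ and every $\phi\in\mathcal{S}_\sigma^T(D_+)$. A weak solution on $D_-\times[0,T]$ is defined in the same way with $D_-$ in place of $D_+$. Reflection: for $f:D_\pm\to\mathbb{R}^3$, $f_R:D_\mp\to\mathbb{R}^3$ is $f_R(x,y,z):=(f_1(x,y,-z),\,f_2(x,y,-z),\,-f_3(x,y,-z))$; for time-dependent fields this is applied at each time. *)

theory Defs
  imports "HOL-Analysis.Analysis"
begin

(* Functions on T^2 x R (T = R / 2 pi Z) are functions on real^3 that are 2 pi-periodic in the first
   two coordinates, and integrals over T^2 x I are integrals over the cell [0, 2 pi)^2 x I. A function
   on a subset D of T^2 x R is a total function of which only the values on D (the preimage in real^3)
   are ever used. Time-dependent fields take the time as first argument. *)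

(* Iterated partial derivatives relative to S. The sets S used below are convex with nonempty interior,
   so that derivatives within S are unique at every point of S, boundary points included. *)
primrec partials ::
  "'a::euclidean_space set \<Rightarrow> 'a list \<Rightarrow> ('a \<Rightarrow> 'b::real_normed_vector) \<Rightarrow> 'a \<Rightarrow> 'b" where
  "partials S [] f = f"
| "partials S (b # bs) f = (\<lambda>x. frechet_derivative (partials S bs f) (at x within S) b)"

definition C_infinity_on :: "'a::euclidean_space set \<Rightarrow> ('a \<Rightarrow> 'b::real_normed_vector) \<Rightarrow> bool" where
  "C_infinity_on S f \<longleftrightarrow> (\<forall>bs\<in>lists Basis. partials S bs f differentiable_on S)"

definition grad_on :: "(real^3) set \<Rightarrow> (real^3 \<Rightarrow> real^3) \<Rightarrow> real^3 \<Rightarrow> real^3^3" where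
  "grad_on D f x = matrix (frechet_derivative f (at x within D))"

definition div_on :: "(real^3) set \<Rightarrow> (real^3 \<Rightarrow> real^3) \<Rightarrow> real^3 \<Rightarrow> real" where
  "div_on D f x = trace (grad_on D f x)"

definition D_plus :: "(real^3) set" where "D_plus = {x. 0 \<le> x $ 3}"

definition D_minus :: "(real^3) set" where "D_minus = {x. x $ 3 \<le> 0}"

definition n_plus :: "real^3" where "n_plus = - axis 3 1"

definition n_minus :: "real^3" where "n_minus = axis 3 1"

definition periodic_on :: "(real^3) set \<Rightarrow> (real^3 \<Rightarrow> 'b) \<Rightarrow> bool" where
  "periodic_on D f \<longleftrightarrow>
     (\<forall>x\<in>D. f (x + axis 1 (2 * pi)) = f x \<and> f (x + axis 2 (2 * pi)) = f x)"

definition cell :: "(real^3) set \<Rightarrow> (real^3) set" where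
  "cell D = {x\<in>D. 0 \<le> x $ 1 \<and> x $ 1 < 2 * pi \<and> 0 \<le> x $ 2 \<and> x $ 2 < 2 * pi}"

(* Also used for matrix fields: the inner product of real^3^3 is F_ij G_ij. *)
definition pairing :: "(real^3) set \<Rightarrow> (real^3 \<Rightarrow> 'b::real_inner) \<Rightarrow> (real^3 \<Rightarrow> 'b) \<Rightarrow> real" where
  "pairing D f g = (LINT x:cell D|lebesgue. f x \<bullet> g x)"

(* Representatives of the elements of L^2(D); no quotient by a.e. equality is taken. *)
definition L2 :: "(real^3) set \<Rightarrow> (real^3 \<Rightarrow> real^3) set" where
  "L2 D = {f. periodic_on D f \<and> f \<in> borel_measurable (lebesgue_on (cell D)) \<and>
              set_integrable lebesgue (cell D) (\<lambda>x. (norm (f x))\<^sup>2)}"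

definition L2_norm :: "(real^3) set \<Rightarrow> (real^3 \<Rightarrow> real^3) \<Rightarrow> real" where
  "L2_norm D f = sqrt (pairing D f f)"

definition schwartz :: "(real^3 \<Rightarrow> real^3) set" where
  "schwartz = {f. C_infinity_on UNIV f \<and> periodic_on UNIV f \<and>
     (\<forall>bs\<in>lists Basis. \<forall>k::nat. bounded (range (\<lambda>x. \<bar>x $ 3\<bar> ^ k *\<^sub>R partials UNIV bs f x)))}"

definition schwartz_sigma :: "(real^3 \<Rightarrow> real^3) set" where
  "schwartz_sigma = {f\<in>schwartz. \<forall>x. div_on UNIV f x = 0}"

definition schwartz_on :: "(real^3) set \<Rightarrow> (real^3 \<Rightarrow> real^3) set" where
  "schwartz_on D = {f. \<exists>g\<in>schwartz. \<forall>x\<in>D. f x = g x}"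

definition schwartz_sigma_on :: "(real^3) set \<Rightarrow> (real^3 \<Rightarrow> real^3) set" where
  "schwartz_sigma_on D = {f. \<exists>g\<in>schwartz_sigma. \<forall>x\<in>D. f x = g x}"

(* The completion is realised as the closure in L^2(D). *)
definition H_sigma :: "(real^3) set \<Rightarrow> (real^3 \<Rightarrow> real^3) set" where
  "H_sigma D = {f\<in>L2 D. \<exists>\<phi>.
     (\<forall>k::nat. \<phi> k \<in> schwartz_on D \<and> (\<forall>x\<in>D. div_on D (\<phi> k) x = 0) \<and>
               (\<forall>x. x $ 3 = 0 \<longrightarrow> \<phi> k x $ 3 = 0)) \<and>
     (\<lambda>k. L2_norm D (\<lambda>x. f x - \<phi> k x)) \<longlonglongrightarrow> 0}"

definition C_weak :: "(real^3) set \<Rightarrow> real \<Rightarrow> (real \<Rightarrow> real^3 \<Rightarrow> real^3) set" where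
  "C_weak D T = {u. (\<forall>t\<in>{0..T}. u t \<in> H_sigma D) \<and>
                    (\<forall>\<phi>\<in>L2 D. continuous_on {0..T} (\<lambda>t. pairing D (u t) \<phi>))}"

definition test_fields :: "(real^3) set \<Rightarrow> real \<Rightarrow> (real \<Rightarrow> real^3 \<Rightarrow> real^3) set" where
  "test_fields D T = {\<psi>. C_infinity_on ({0..T} \<times> D) (\<lambda>(t, x). \<psi> t x) \<and>
                         (\<forall>t\<in>{0..T}. \<psi> t \<in> schwartz_sigma_on D)}"

(* The boundary {x_3 = 0} is T^2, i.e. real^2 with periodic functions. Since T^2 x [0, T] is compact,
   its test functions are all smooth functions, with no condition at t = 0 and t = T. *)
definition bdry_tests :: "real \<Rightarrow> (real \<Rightarrow> real^2 \<Rightarrow> real) set" where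
  "bdry_tests T = {g. C_infinity_on ({0..T} \<times> UNIV) (\<lambda>(t, y). g t y) \<and>
     (\<forall>t\<in>{0..T}. \<forall>y. g t (y + axis 1 (2 * pi)) = g t y \<and> g t (y + axis 2 (2 * pi)) = g t y)}"

(* Linear functionals that are continuous for the seminorms of C^infinity(T^2 x [0, T]). By linearity
   the estimate also makes p g depend only on the values of g at times in [0, T]. *)
definition bdry_distributions :: "real \<Rightarrow> ((real \<Rightarrow> real^2 \<Rightarrow> real) \<Rightarrow> real) set" where
  "bdry_distributions T = {p.
     (\<forall>g\<in>bdry_tests T. \<forall>h\<in>bdry_tests T. p (\<lambda>t y. g t y + h t y) = p g + p h) \<and>
     (\<forall>g\<in>bdry_tests T. \<forall>c. p (\<lambda>t y. c * g t y) = c * p g) \<and>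
     (\<exists>C N. \<forall>g\<in>bdry_tests T. \<forall>B.
        (\<forall>bs\<in>lists Basis. length bs \<le> N \<longrightarrow>
           (\<forall>z\<in>{0..T} \<times> UNIV. \<bar>partials ({0..T} \<times> UNIV) bs (\<lambda>(t, y). g t y) z\<bar> \<le> B)) \<longrightarrow>
        \<bar>p g\<bar> \<le> C * B)}"

(* Smooth approximations from above of the indicator function of (-infinity, t]. *)
definition cutoffs_to :: "real \<Rightarrow> (nat \<Rightarrow> real \<Rightarrow> real) \<Rightarrow> bool" where
  "cutoffs_to t \<eta> \<longleftrightarrow>
     (\<forall>k. C_infinity_on UNIV (\<eta> k) \<and> antimono (\<eta> k) \<and> (\<forall>s. 0 \<le> \<eta> k s) \<and> (\<forall>s\<le>t. \<eta> k s = 1)) \<and>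
     (\<forall>s>t. (\<lambda>k. \<eta> k s) \<longlonglongrightarrow> 0)"

(* The pairing of the distribution p with g over {x_3 = 0} x [0, t] exists and has the value v. It is
   the limit of p (eta_k g) for smooth eta_k converging to the indicator of [0, t]; if p is a smooth
   (or just integrable) function this is the integral of p g over T^2 x [0, t], and for t = T it
   is p g. *)
definition has_bdry_pairing ::
  "((real \<Rightarrow> real^2 \<Rightarrow> real) \<Rightarrow> real) \<Rightarrow> real \<Rightarrow> (real \<Rightarrow> real^2 \<Rightarrow> real) \<Rightarrow> real \<Rightarrow> bool" where
  "has_bdry_pairing p t g v \<longleftrightarrow>
     (\<forall>\<eta>. cutoffs_to t \<eta> \<longrightarrow> (\<lambda>k. p (\<lambda>\<tau> y. \<eta> k \<tau> * g \<tau> y)) \<longlonglongrightarrow> v)"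

definition bdry_trace :: "(real \<Rightarrow> real^3 \<Rightarrow> real^3) \<Rightarrow> real^3 \<Rightarrow> real \<Rightarrow> real^2 \<Rightarrow> real" where
  "bdry_trace \<phi> n t y = \<phi> t (vector [y $ 1, y $ 2, 0]) \<bullet> n"

definition euler_weak_solution ::
  "(real^3) set \<Rightarrow> real^3 \<Rightarrow> real \<Rightarrow> (real \<Rightarrow> real^3 \<Rightarrow> real^3) \<Rightarrow>
   ((real \<Rightarrow> real^2 \<Rightarrow> real) \<Rightarrow> real) \<Rightarrow> bool" where
  "euler_weak_solution D n T u p \<longleftrightarrow>
     u \<in> C_weak D T \<and> p \<in> bdry_distributions T \<and>
     (\<forall>t\<in>{0..T}. \<forall>\<phi>\<in>test_fields D T. \<exists>P.
        has_bdry_pairing p t (bdry_trace \<phi> n) P \<and>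
        pairing D (u t) (\<phi> t) - pairing D (u 0) (\<phi> 0)
          - (LINT \<tau>:{0..t}|lebesgue.
               pairing D (u \<tau>) (\<lambda>x. vector_derivative (\<lambda>s. \<phi> s x) (at \<tau> within {0..T})))
        = (LINT \<tau>:{0..t}|lebesgue.
               pairing D (\<lambda>x. \<chi> i j. u \<tau> x $ i * u \<tau> x $ j) (grad_on D (\<phi> \<tau>)))
          - P)"

definition reflect :: "(real^3 \<Rightarrow> real^3) \<Rightarrow> real^3 \<Rightarrow> real^3" where
  "reflect f x =
     (let y = f (vector [x $ 1, x $ 2, - x $ 3]) in vector [y $ 1, y $ 2, - y $ 3])"

end

(* The flip of the third coordinate is a linear isometric involution R that maps every coordinate
   axis to itself, and reflect f = R o f o R. Conjugation by R preserves Lebesgue measure, all the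
   function spaces and the divergence, and turns the gradient A into R A R, so that
   (Ru (x) Ru) : R A R = (u (x) u) : A. Since R maps the one outward normal to the other, the boundary
   term of a test field on the image domain is literally that of its reflection, and the weak
   formulation tested with phi becomes the original one tested with the reflection of phi. *)

theory Submission
  imports Defs
begin

section \<open>The flip of the vertical coordinate\<close>

definition flip :: "real^3 \<Rightarrow> real^3" where
  "flip x = vector [x $ 1, x $ 2, - x $ 3]"

lemma flip_nth [simp]: "flip x $ 1 = x $ 1" "flip x $ 2 = x $ 2" "flip x $ 3 = - x $ 3"
  by (simp_all add: flip_def)

lemma reflect_eq_flip: "reflect f x = flip (f (flip x))"
  by (simp add: reflect_def flip_def Let_def)

lemma flip_flip [simp]: "flip (flip x) = x"
  by (simp add: vec_eq_iff forall_3)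

lemma reflect_reflect [simp]: "reflect (reflect f) = f"
  by (simp add: reflect_eq_flip fun_eq_iff)

lemma bounded_linear_flip: "bounded_linear flip"
  by (auto simp: vec_eq_iff forall_3 intro!: linear_conv_bounded_linear[THEN iffD1] linearI)

lemmas linear_flip = bounded_linear.linear[OF bounded_linear_flip]
lemmas flip_diff = linear_diff[OF linear_flip]

lemma flip_inner_flip [simp]: "flip x \<bullet> flip y = x \<bullet> y"
  by (simp add: inner_vec_def sum_3)

lemma flip_inner: "flip x \<bullet> y = x \<bullet> flip y"
  by (simp add: inner_vec_def sum_3)

lemma norm_flip [simp]: "norm (flip x) = norm x"
  by (simp add: norm_eq_sqrt_inner)

lemma mem_flip_image: "x \<in> flip ` S \<longleftrightarrow> flip x \<in> S"
  by (metis flip_flip image_iff)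

lemma flip_image_flip_image [simp]: "flip ` flip ` S = S"
  by (simp add: image_image)

lemma flip_image_UNIV [simp]: "flip ` UNIV = UNIV"
  by (auto simp: mem_flip_image)

lemma real3_Basis_cases:
  assumes "b \<in> (Basis :: (real^3) set)"
  obtains "b = axis 1 1" | "b = axis 2 1" | "b = axis 3 1"
  using assms by (auto simp: Basis_vec_def UNIV_3)

lemma flip_axis: "flip (axis 1 c) = axis 1 c" "flip (axis 2 c) = axis 2 c"
    "flip (axis 3 c) = - axis 3 c"
  by (simp_all add: vec_eq_iff forall_3 axis_def)

text \<open>Each coordinate axis is an eigenspace, and \<open>flip b \<bullet> b\<close> is a
  uniform formula for its eigenvalue, a sign. This is the factor \<open>s b\<close> in the lemmas on
  conjugated derivatives below.\<close>

lemma flip_Basis: "b \<in> Basis \<Longrightarrow> flip b = (flip b \<bullet> b) *\<^sub>R b"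
  by (erule real3_Basis_cases) (simp_all add: flip_axis inner_axis_axis)

lemma flip_D_plus: "flip ` D_plus = D_minus"
  by (auto simp: mem_flip_image D_plus_def D_minus_def)

lemma flip_n_plus: "flip n_plus = n_minus"
  by (simp add: n_plus_def n_minus_def flip_axis linear_neg[OF linear_flip])

lemma flip_cell: "cell (flip ` D) = flip ` cell D"
  by (auto simp: cell_def mem_flip_image)

section \<open>Invariance of integrals\<close>

text \<open>The flip is diagonal with entries of modulus 1, so the density factor in the affine
  change of variables is a product of ones.\<close>

lemma
  shows lebesgue_flip: "distr lebesgue lebesgue flip = lebesgue"
    and flip_measurable [measurable]: "flip \<in> lebesgue \<rightarrow>\<^sub>M lebesgue"
proof -
  define c where "c j = flip j \<bullet> j" for j
  have c: "\<bar>c j\<bar> = 1" if "j \<in> Basis" for j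
    using that by (cases rule: real3_Basis_cases) (simp_all add: c_def flip_axis inner_axis_axis)
  \<comment> \<open>The diagonal form, with translation part 0, is the shape required by the affine
    change of variables.\<close>
  have *: "flip = (\<lambda>x. 0 + (\<Sum>j\<in>Basis. (c j * (x \<bullet> j)) *\<^sub>R j))"
  proof
    fix x
    have "flip x = flip (\<Sum>j\<in>Basis. (x \<bullet> j) *\<^sub>R j)"
      by (simp add: euclidean_representation)
    also have "\<dots> = (\<Sum>j\<in>Basis. (x \<bullet> j) *\<^sub>R flip j)"
      by (simp add: linear_sum[OF linear_flip] linear_cmul[OF linear_flip])
    also have "\<dots> = (\<Sum>j\<in>Basis. (c j * (x \<bullet> j)) *\<^sub>R j)"
      by (intro sum.cong refl, subst flip_Basis) (simp_all add: c_def mult.commute)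
    finally show "flip x = 0 + (\<Sum>j\<in>Basis. (c j * (x \<bullet> j)) *\<^sub>R j)" by simp
  qed
  have nz: "\<And>j. j \<in> Basis \<Longrightarrow> c j \<noteq> 0" using c by force
  show "flip \<in> lebesgue \<rightarrow>\<^sub>M lebesgue"
    unfolding * by (rule lebesgue_affine_measurable[OF nz])
  have "lebesgue = density (distr lebesgue lebesgue flip) (\<lambda>_. (\<Prod>j\<in>Basis. \<bar>c j\<bar>))"
    unfolding * by (rule lebesgue_affine_euclidean[OF nz])
  also have "(\<Prod>j\<in>Basis. \<bar>c j\<bar>) = 1" using c by simp
  finally show "distr lebesgue lebesgue flip = lebesgue"
    by (simp add: density_1)
qed

lemma integrable_flip:
  fixes f :: "real^3 \<Rightarrow> 'b::{banach, second_countable_topology}"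
  assumes "integrable lebesgue f"
  shows "integrable lebesgue (\<lambda>x. f (flip x))"
  using assms integrable_distr[of flip lebesgue lebesgue f] by (simp add: lebesgue_flip)

lemma integral_flip:
  fixes f :: "real^3 \<Rightarrow> 'b::{banach, second_countable_topology}"
  shows "(LINT x|lebesgue. f (flip x)) = (LINT x|lebesgue. f x)"
proof (cases "integrable lebesgue f")
  case True
  then show ?thesis
    using integral_distr[of flip lebesgue lebesgue f] by (simp add: lebesgue_flip)
next
  \<comment> \<open>The flip is an involution, so integrability of the composite would give that of
    \<open>f\<close> back; hence both integrals take the default value 0.\<close>
  case False
  then have "\<not> integrable lebesgue (\<lambda>x. f (flip x))"
    using integrable_flip[of "\<lambda>x. f (flip x)"] by auto
  with False show ?thesis by (simp add: not_integrable_integral_eq)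
qed

lemma indicator_flip: "indicator (flip ` S) x = indicator S (flip x)"
  by (simp add: indicator_def mem_flip_image)

text \<open>The change of variables behind every term of the weak formulation. The integrands are
  compared only on \<open>D\<close>, which contains the cell, since derivatives of a test field can
  be computed only there.\<close>

lemma pairing_flip:
  assumes "\<And>x. x \<in> D \<Longrightarrow> f' (flip x) \<bullet> g' (flip x) = f x \<bullet> g x"
  shows "pairing (flip ` D) f' g' = pairing D f g"
proof -
  have "pairing (flip ` D) f' g'
      = (LINT x|lebesgue. indicator (cell (flip ` D)) x *\<^sub>R (f' x \<bullet> g' x))"
    by (simp add: pairing_def set_lebesgue_integral_def)
  also have "\<dots> = (LINT x|lebesgue. indicator (cell (flip ` D)) (flip x) *\<^sub>R (f' (flip x) \<bullet> g' (flip x)))"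
    by (rule integral_flip[symmetric])
  also have "\<dots> = (LINT x|lebesgue. indicator (cell D) x *\<^sub>R (f x \<bullet> g x))"
    unfolding flip_cell indicator_flip flip_flip using assms
    by (intro Bochner_Integration.integral_cong refl)
       (auto simp: cell_def split: split_indicator)
  finally show ?thesis by (simp add: pairing_def set_lebesgue_integral_def)
qed

lemma L2_norm_reflect:
  "L2_norm (flip ` D) (\<lambda>x. reflect f x - reflect g x) = L2_norm D (\<lambda>x. f x - g x)"
  unfolding L2_norm_def
  by (intro arg_cong[where f = sqrt] pairing_flip)
     (simp add: reflect_eq_flip flip: flip_diff)

lemma periodic_on_reflect:
  assumes "periodic_on D f"
  shows "periodic_on (flip ` D) (reflect f)"
  using assms
  by (auto simp: periodic_on_def reflect_eq_flip linear_add[OF linear_flip] flip_axis mem_flip_image)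

lemma L2_reflect:
  assumes "f \<in> L2 D"
  shows "reflect f \<in> L2 (flip ` D)"
proof -
  from assms have f: "periodic_on D f" "f \<in> borel_measurable (lebesgue_on (cell D))"
      "set_integrable lebesgue (cell D) (\<lambda>x. (norm (f x))\<^sup>2)"
    by (auto simp: L2_def)
  have "flip \<in> lebesgue_on (cell (flip ` D)) \<rightarrow>\<^sub>M lebesgue_on (cell D)"
    by (rule measurable_restrict_space3[OF flip_measurable]) (auto simp: flip_cell)
  from measurable_compose[OF this f(2)]
  have "(\<lambda>x. f (flip x)) \<in> borel_measurable (lebesgue_on (cell (flip ` D)))" .
  then have "(\<lambda>x. flip (f (flip x))) \<in> borel_measurable (lebesgue_on (cell (flip ` D)))"
    by (rule measurable_compose)
       (intro borel_measurable_continuous_onI linear_continuous_on bounded_linear_flip)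
  moreover have "set_integrable lebesgue (cell (flip ` D)) (\<lambda>x. (norm (reflect f x))\<^sup>2)"
    using integrable_flip[OF f(3)[unfolded set_integrable_def]]
    by (simp add: set_integrable_def flip_cell indicator_flip reflect_eq_flip)
  ultimately show ?thesis
    using periodic_on_reflect[OF f(1)] by (simp add: L2_def reflect_eq_flip[abs_def])
qed

section \<open>Iterated derivatives under coordinate symmetries\<close>

text \<open>This is what makes derivatives within \<open>S\<close> unique, so that
  \<^const>\<open>frechet_derivative\<close> (a choice operator) can be computed.\<close>
definition axis_accessible :: "'a::euclidean_space set \<Rightarrow> bool" where
  "axis_accessible S \<longleftrightarrow>
     (\<forall>x\<in>S. \<forall>i\<in>Basis. \<forall>e>0. \<exists>d. 0 < \<bar>d\<bar> \<and> \<bar>d\<bar> < e \<and> x + d *\<^sub>R i \<in> S)"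

lemma frechet_derivative_accessible:
  assumes "axis_accessible S" "x \<in> S" "(f has_derivative f') (at x within S)"
  shows "frechet_derivative f (at x within S) = f'"
proof (rule frechet_derivative_unique_within)
  show "(f has_derivative frechet_derivative f (at x within S)) (at x within S)"
    using assms(3) by (auto simp: frechet_derivative_works[symmetric] differentiable_def)
qed (use assms in \<open>auto simp: axis_accessible_def\<close>)

lemma axis_accessible_UNIV: "axis_accessible UNIV"
  unfolding axis_accessible_def
proof (intro ballI allI impI)
  fix x i :: 'a and e :: real
  assume "e > 0"
  then show "\<exists>d. 0 < \<bar>d\<bar> \<and> \<bar>d\<bar> < e \<and> x + d *\<^sub>R i \<in> UNIV"
    by (intro exI[of _ "e / 2"]) auto
qed

lemma axis_accessible_D_plus: "axis_accessible D_plus"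
  unfolding axis_accessible_def
proof (intro ballI allI impI)
  fix x i :: "real^3" and e :: real
  assume "x \<in> D_plus" "i \<in> Basis" "e > 0"
  \<comment> \<open>A positive step along a basis vector never lowers the third coordinate, so it
    stays in the upper half-space even from the boundary.\<close>
  from \<open>i \<in> Basis\<close> have "0 \<le> i $ 3"
    by (cases rule: real3_Basis_cases) (simp_all add: axis_def)
  with \<open>x \<in> D_plus\<close> \<open>e > 0\<close> show "\<exists>d. 0 < \<bar>d\<bar> \<and> \<bar>d\<bar> < e \<and> x + d *\<^sub>R i \<in> D_plus"
    by (intro exI[of _ "e / 2"]) (auto simp: D_plus_def)
qed

lemma axis_accessible_Icc:
  assumes "a < (b::real)"
  shows "axis_accessible {a..b}"
  unfolding axis_accessible_def
proof (intro ballI allI impI)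
  fix x i e :: real
  assume *: "x \<in> {a..b}" "i \<in> Basis" "e > 0"
  show "\<exists>d. 0 < \<bar>d\<bar> \<and> \<bar>d\<bar> < e \<and> x + d *\<^sub>R i \<in> {a..b}"
  proof (cases "x = b")
    case True
    with * assms show ?thesis
      \<comment> \<open>At the right endpoint the step has to go left. The bound
        \<open>b - a\<close> keeps it inside the interval, and halving \<open>e\<close> keeps its
        length strictly below \<open>e\<close>.\<close>
      by (intro exI[of _ "- min (e / 2) (b - a)"]) (auto simp: min_def)
  next
    case False
    with * assms show ?thesis
      by (intro exI[of _ "min (e / 2) (b - x)"]) (auto simp: min_def)
  qed
qed

lemma axis_accessible_Times:
  assumes "axis_accessible A" "axis_accessible B"
  shows "axis_accessible (A \<times> B)"
  unfolding axis_accessible_def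
proof (intro ballI allI impI)
  fix z i :: "'a \<times> 'b" and e :: real
  assume "z \<in> A \<times> B" "i \<in> Basis" "e > 0"
  then consider j where "i = (j, 0)" "j \<in> Basis" | j where "i = (0, j)" "j \<in> Basis"
    by (auto simp: Basis_prod_def)
  then show "\<exists>d. 0 < \<bar>d\<bar> \<and> \<bar>d\<bar> < e \<and> z + d *\<^sub>R i \<in> A \<times> B"
  proof cases
    case 1
    with assms(1) \<open>z \<in> A \<times> B\<close> \<open>e > 0\<close> show ?thesis
      unfolding axis_accessible_def by (cases z) force
  next
    case 2
    with assms(2) \<open>z \<in> A \<times> B\<close> \<open>e > 0\<close> show ?thesis
      unfolding axis_accessible_def by (cases z) force
  qed
qed

text \<open>A step \<open>d\<close> along an axis becomes the step \<open>d * s i\<close> along the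
  same axis, of the same length because \<open>s i\<close> is a sign.\<close>

lemma axis_accessible_image:
  assumes S: "axis_accessible S" and M: "linear M"
    and Basis: "\<And>b. b \<in> Basis \<Longrightarrow> M b = s b *\<^sub>R b" "\<And>b. b \<in> Basis \<Longrightarrow> \<bar>s b\<bar> = (1::real)"
  shows "axis_accessible (M ` S)"
  unfolding axis_accessible_def
proof (intro ballI allI impI)
  fix y i :: 'a and e :: real
  assume "y \<in> M ` S" and i: "i \<in> Basis" and "e > 0"
  then obtain x where x: "x \<in> S" "y = M x" by auto
  with S i \<open>e > 0\<close> obtain d where d: "0 < \<bar>d\<bar>" "\<bar>d\<bar> < e" "x + d *\<^sub>R i \<in> S"
    unfolding axis_accessible_def by blast
  have "M (x + d *\<^sub>R i) = y + (d * s i) *\<^sub>R i"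
    by (simp add: linear_add[OF M] linear_cmul[OF M] Basis(1)[OF i] x)
  with d(3) have "y + (d * s i) *\<^sub>R i \<in> M ` S" by (metis imageI)
  with d(1,2) Basis(2)[OF i] show "\<exists>d. 0 < \<bar>d\<bar> \<and> \<bar>d\<bar> < e \<and> y + d *\<^sub>R i \<in> M ` S"
    by (intro exI[of _ "d * s i"]) (simp add: abs_mult)
qed

lemma axis_accessible_flip: "axis_accessible S \<Longrightarrow> axis_accessible (flip ` S)"
  by (rule axis_accessible_image[OF _ linear_flip flip_Basis])
     (auto elim!: real3_Basis_cases simp: flip_axis inner_axis_axis)

lemma has_derivative_conj:
  assumes "bounded_linear L" "bounded_linear M" and inv: "\<And>x. M (M x) = x"
    and "M x \<in> S" and f: "(f has_derivative f') (at (M x) within S)"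
  shows "((\<lambda>x. L (f (M x))) has_derivative (\<lambda>h. L (f' (M h)))) (at x within M ` S)"
proof -
  \<comment> \<open>The chain rule asks for a derivative of \<open>f\<close> within the image under
    \<open>M\<close> of the new domain; for an involution this image is the original
    \<open>S\<close>.\<close>
  have "M ` M ` S = S" by (simp add: image_image inv)
  with f have "(f has_derivative f') (at (M x) within M ` M ` S)" by simp
  from has_derivative_in_compose[OF bounded_linear_imp_has_derivative[OF assms(2)] this]
  have "((\<lambda>x. f (M x)) has_derivative (\<lambda>h. f' (M h))) (at x within M ` S)" .
  then show ?thesis by (rule bounded_linear.has_derivative[OF assms(1)])
qed

text \<open>Differentiating in direction \<open>b\<close> brings out the factor \<open>s b\<close>,
  since \<open>M\<close> rescales \<open>b\<close> by it, while the linear \<open>L\<close> passes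
  through the derivative. \<open>L\<close> and \<open>M\<close> are separate because a
  time-dependent field has values in space but arguments in space-time.\<close>

lemma partials_conj:
  fixes f :: "'a::euclidean_space \<Rightarrow> 'b::real_normed_vector"
  assumes L: "bounded_linear L" and M: "bounded_linear M" and inv: "\<And>x. M (M x) = x"
    and Basis: "\<And>b. b \<in> Basis \<Longrightarrow> M b = s b *\<^sub>R b"
    and acc: "axis_accessible (M ` S)"
    and f: "C_infinity_on S f" and bs: "bs \<in> lists Basis" and x: "x \<in> M ` S"
  shows "partials (M ` S) bs (\<lambda>x. L (f (M x))) x = prod_list (map s bs) *\<^sub>R L (partials S bs f (M x))"
  using bs x
proof (induction bs arbitrary: x rule: list.induct)
  case Nil
  then show ?case by simp
next
  case (Cons b bs)
  define c where "c = prod_list (map s bs)"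
  define F' where "F' = frechet_derivative (partials S bs f) (at (M x) within S)"
  have Mx: "M x \<in> S" using Cons.prems inv by auto
  have "partials S bs f differentiable_on S"
    using f Cons.prems(1) unfolding C_infinity_on_def by (meson Cons_in_lists_iff)
  with Mx have F': "(partials S bs f has_derivative F') (at (M x) within S)"
    by (auto simp: differentiable_on_def F'_def frechet_derivative_works[symmetric])
  have cL: "bounded_linear (\<lambda>y. c *\<^sub>R L y)"
    using L by (rule bounded_linear_const_scaleR)
  have "((\<lambda>x. c *\<^sub>R L (partials S bs f (M x))) has_derivative (\<lambda>h. c *\<^sub>R L (F' (M h))))
      (at x within M ` S)"
    by (rule has_derivative_conj[OF cL M inv Mx F'])
  then have "(partials (M ` S) bs (\<lambda>x. L (f (M x))) has_derivative (\<lambda>h. c *\<^sub>R L (F' (M h))))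
      (at x within M ` S)"
    by (rule has_derivative_transform[rotated 2]) (use Cons in \<open>auto simp: c_def\<close>)
  from frechet_derivative_accessible[OF acc Cons.prems(2) this]
  have "partials (M ` S) (b # bs) (\<lambda>x. L (f (M x))) x = c *\<^sub>R L (F' (M b))"
    by simp
  also have "L (F' (M b)) = s b *\<^sub>R L (F' b)"
    using Cons.prems(1) Basis[of b]
    by (simp add: linear_cmul[OF has_derivative_linear[OF F']]
        linear_cmul[OF bounded_linear.linear[OF L]])
  finally show ?case by (simp add: c_def F'_def mult.commute)
qed

lemma C_infinity_on_conj:
  fixes f :: "'a::euclidean_space \<Rightarrow> 'b::real_normed_vector"
  assumes L: "bounded_linear L" and M: "bounded_linear M" and inv: "\<And>x. M (M x) = x"
    and Basis: "\<And>b. b \<in> Basis \<Longrightarrow> M b = s b *\<^sub>R b"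
    and acc: "axis_accessible (M ` S)" and f: "C_infinity_on S f"
  shows "C_infinity_on (M ` S) (\<lambda>x. L (f (M x)))"
  unfolding C_infinity_on_def differentiable_on_def
proof (intro ballI)
  fix bs :: "'a list" and x
  assume bs: "bs \<in> lists Basis" and x: "x \<in> M ` S"
  define c where "c = prod_list (map s bs)"
  have Mx: "M x \<in> S" using x inv by auto
  obtain F' where F': "(partials S bs f has_derivative F') (at (M x) within S)"
    using f bs Mx unfolding C_infinity_on_def differentiable_on_def differentiable_def by blast
  have "((\<lambda>x. c *\<^sub>R L (partials S bs f (M x))) has_derivative (\<lambda>h. c *\<^sub>R L (F' (M h))))
      (at x within M ` S)"
    by (rule has_derivative_conj[OF bounded_linear_const_scaleR[OF L] M inv Mx F'])
  then have "(partials (M ` S) bs (\<lambda>x. L (f (M x))) has_derivative (\<lambda>h. c *\<^sub>R L (F' (M h))))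
      (at x within M ` S)"
    by (rule has_derivative_transform[rotated 2])
       (use partials_conj[OF L M inv Basis acc f bs] x in \<open>auto simp: c_def\<close>)
  then show "partials (M ` S) bs (\<lambda>x. L (f (M x))) differentiable at x within M ` S"
    by (auto simp: differentiable_def)
qed

lemma C_infinity_on_imp_differentiable:
  "C_infinity_on S f \<Longrightarrow> x \<in> S \<Longrightarrow> f differentiable (at x within S)"
  by (metis C_infinity_on_def differentiable_on_def lists.Nil partials.simps(1))

section \<open>Gradient and divergence of reflected fields\<close>

lemma reflect_has_derivative:
  assumes "(f has_derivative f') (at x within D)" "x \<in> D"
  shows "(reflect f has_derivative (\<lambda>h. flip (f' (flip h)))) (at (flip x) within flip ` D)"
proof -
  have "((\<lambda>x. flip (f (flip x))) has_derivative (\<lambda>h. flip (f' (flip h)))) (at (flip x) within flip ` D)"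
    by (rule has_derivative_conj[OF bounded_linear_flip bounded_linear_flip]) (use assms in auto)
  then show ?thesis by (simp add: reflect_eq_flip[abs_def])
qed

text \<open>The gradient becomes R A R. Stating this through the action on vectors lets
  \<open>flip\<close> stay a function instead of a matrix.\<close>

lemma grad_on_reflect:
  assumes "axis_accessible D" "x \<in> D" "f differentiable (at x within D)"
  shows "grad_on (flip ` D) (reflect f) (flip x) *v v = flip (grad_on D f x *v flip v)"
proof -
  from assms(3) obtain f' where f': "(f has_derivative f') (at x within D)"
    by (auto simp: differentiable_def)
  have "frechet_derivative f (at x within D) = f'"
    by (rule frechet_derivative_accessible[OF assms(1,2) f'])
  moreover have "frechet_derivative (reflect f) (at (flip x) within flip ` D) = (\<lambda>h. flip (f' (flip h)))"
    by (rule frechet_derivative_accessible[OF axis_accessible_flip[OF assms(1)] _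
          reflect_has_derivative[OF f' assms(2)]])
       (use assms in auto)
  moreover have "linear f'" using f' by (rule has_derivative_linear)
  moreover have "linear (\<lambda>h. flip (f' (flip h)))"
    using linear_compose[OF linear_compose[OF linear_flip \<open>linear f'\<close>] linear_flip]
    by (simp add: o_def)
  ultimately show ?thesis by (simp add: grad_on_def matrix_works)
qed

text \<open>Expresses the trace through the action on vectors, the form in which
  \<open>grad_on_reflect\<close> applies.\<close>

lemma trace_eq_inner_axis: "trace (A :: real^3^3) = (\<Sum>i\<in>UNIV. (A *v axis i 1) $ i)"
  by (simp add: trace_def matrix_vector_mult_basis column_def)

text \<open>Only the third diagonal entry of R A R picks up signs, and it picks up two of
  them.\<close>

lemma div_on_reflect:
  assumes "axis_accessible D" "x \<in> D" "f differentiable (at x within D)"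
  shows "div_on (flip ` D) (reflect f) (flip x) = div_on D f x"
  by (simp add: div_on_def trace_eq_inner_axis sum_3 grad_on_reflect[OF assms] flip_axis
      linear_neg[OF matrix_vector_mul_linear])

text \<open>Turns the convection term into a quadratic form of the gradient, so that
  \<open>grad_on_reflect\<close> and the isometry of \<open>flip\<close> apply.\<close>

lemma dyad_inner: "(\<chi> i j. w $ i * w $ j) \<bullet> (A :: real^3^3) = w \<bullet> (A *v w)"
  by (simp add: inner_vec_def sum_3 matrix_vector_mult_def algebra_simps)

section \<open>Invariance of the function spaces\<close>

text \<open>The weights depend only on the modulus of the third coordinate, which
  \<open>flip\<close> preserves, and each derivative is changed only by a sign and by
  \<open>flip\<close>.\<close>

lemma schwartz_reflect:
  assumes "f \<in> schwartz"
  shows "reflect f \<in> schwartz"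
proof -
  have f: "C_infinity_on UNIV f" "periodic_on UNIV f"
    and bdd: "\<And>bs k. bs \<in> lists Basis \<Longrightarrow>
      bounded (range (\<lambda>x. \<bar>x $ 3\<bar> ^ (k::nat) *\<^sub>R partials UNIV bs f x))"
    using assms by (auto simp: schwartz_def)
  have acc: "axis_accessible (flip ` (UNIV :: (real^3) set))"
    by (simp add: axis_accessible_UNIV)
  note conj = bounded_linear_flip bounded_linear_flip flip_flip flip_Basis acc f(1)
  have "bounded (range (\<lambda>x. \<bar>x $ 3\<bar> ^ k *\<^sub>R partials UNIV bs (reflect f) x))"
    if bs: "bs \<in> lists Basis" for bs and k :: nat
  proof -
    define c where "c = prod_list (map (\<lambda>b::real^3. flip b \<bullet> b) bs)"
    have "partials UNIV bs (reflect f) x = c *\<^sub>R flip (partials UNIV bs f (flip x))" for x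
      using partials_conj[OF conj bs, of x] by (simp add: reflect_eq_flip[abs_def] c_def)
    then have "range (\<lambda>x. \<bar>x $ 3\<bar> ^ k *\<^sub>R partials UNIV bs (reflect f) x)
        = range (\<lambda>x. c *\<^sub>R flip (\<bar>flip x $ 3\<bar> ^ k *\<^sub>R partials UNIV bs f (flip x)))"
      by (simp add: linear_cmul[OF linear_flip] mult.commute)
    also have "\<dots> \<subseteq> (\<lambda>y. c *\<^sub>R flip y) ` range (\<lambda>x. \<bar>x $ 3\<bar> ^ k *\<^sub>R partials UNIV bs f x)"
      by blast
    finally show ?thesis
      by (rule bounded_subset[rotated])
         (intro bounded_linear_image bdd bs bounded_linear_const_scaleR bounded_linear_flip)
  qed
  moreover have "C_infinity_on UNIV (reflect f)"
    using C_infinity_on_conj[OF conj] by (simp add: reflect_eq_flip[abs_def])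
  moreover have "periodic_on UNIV (reflect f)"
    using periodic_on_reflect[OF f(2)] by simp
  ultimately show ?thesis by (simp add: schwartz_def)
qed

lemma schwartz_sigma_reflect:
  assumes "f \<in> schwartz_sigma"
  shows "reflect f \<in> schwartz_sigma"
proof -
  have "f differentiable (at x within UNIV)" for x
    using assms C_infinity_on_imp_differentiable[of UNIV f x]
    by (simp add: schwartz_sigma_def schwartz_def)
  from div_on_reflect[OF axis_accessible_UNIV UNIV_I this]
  have "div_on UNIV (reflect f) x = div_on UNIV f (flip x)" for x
    by (metis flip_flip flip_image_UNIV)
  with assms schwartz_reflect show ?thesis by (auto simp: schwartz_sigma_def)
qed

lemma schwartz_on_reflect: "f \<in> schwartz_on D \<Longrightarrow> reflect f \<in> schwartz_on (flip ` D)"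
  unfolding schwartz_on_def
  by (auto simp: reflect_eq_flip intro!: bexI[OF _ schwartz_reflect])

lemma schwartz_sigma_on_reflect:
  "f \<in> schwartz_sigma_on D \<Longrightarrow> reflect f \<in> schwartz_sigma_on (flip ` D)"
  unfolding schwartz_sigma_on_def
  by (auto simp: reflect_eq_flip intro!: bexI[OF _ schwartz_sigma_reflect])

text \<open>Differentiability within \<open>D\<close> is inherited from the smooth extension to the
  whole space; it feeds \<open>div_on_reflect\<close> and \<open>grad_on_reflect\<close>.\<close>

lemma schwartz_on_differentiable:
  assumes "f \<in> schwartz_on D" "x \<in> D"
  shows "f differentiable (at x within D)"
proof -
  obtain g where g: "g \<in> schwartz" "\<And>x. x \<in> D \<Longrightarrow> f x = g x"
    using assms by (auto simp: schwartz_on_def)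
  then have "g differentiable (at x)"
    by (auto simp: schwartz_def dest: C_infinity_on_imp_differentiable)
  then have "g differentiable (at x within D)"
    by (rule differentiable_at_withinI)
  then show ?thesis
    unfolding differentiable_def using has_derivative_transform[OF assms(2), of f g] g(2) by blast
qed

lemma schwartz_sigma_on_subset: "schwartz_sigma_on D \<subseteq> schwartz_on D"
  by (auto simp: schwartz_sigma_on_def schwartz_on_def schwartz_sigma_def)

text \<open>The approximating sequence is reflected term by term. The plane \<open>x $ 3 = 0\<close>
  is mapped to itself and the vertical component only changes sign, so the boundary condition
  survives.\<close>

lemma H_sigma_reflect:
  assumes "axis_accessible D" "f \<in> H_sigma D"
  shows "reflect f \<in> H_sigma (flip ` D)"
proof -
  from assms(2) obtain \<phi> where f: "f \<in> L2 D"
    and \<phi>: "\<And>k::nat. \<phi> k \<in> schwartz_on D" "\<And>k x. x \<in> D \<Longrightarrow> div_on D (\<phi> k) x = 0"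
      "\<And>k x. x $ 3 = 0 \<Longrightarrow> \<phi> k x $ 3 = 0"
      "(\<lambda>k. L2_norm D (\<lambda>x. f x - \<phi> k x)) \<longlonglongrightarrow> 0"
    unfolding H_sigma_def by blast
  have "div_on (flip ` D) (reflect (\<phi> k)) x = 0" if "x \<in> flip ` D" for k x
    using that div_on_reflect[OF assms(1) _ schwartz_on_differentiable[OF \<phi>(1)]] \<phi>(2) by auto
  moreover have "reflect (\<phi> k) x $ 3 = 0" if "x $ 3 = 0" for k x
    using \<phi>(3)[of "flip x" k] that by (simp add: reflect_eq_flip)
  moreover have "(\<lambda>k. L2_norm (flip ` D) (\<lambda>x. reflect f x - reflect (\<phi> k) x)) \<longlonglongrightarrow> 0"
    using \<phi>(4) by (simp add: L2_norm_reflect)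
  ultimately show ?thesis
    unfolding H_sigma_def using L2_reflect[OF f] schwartz_on_reflect[OF \<phi>(1)]
    by (intro CollectI conjI exI[of _ "\<lambda>k. reflect (\<phi> k)"]) auto
qed

text \<open>Since \<open>flip\<close> is self-adjoint, the reflection can be moved to the other
  factor. Weak continuity of the reflected field thus becomes weak continuity of the original one
  against a reflected \<open>L2\<close> function.\<close>

lemma pairing_reflect_left: "pairing (flip ` D) (reflect f) g = pairing D f (reflect g)"
  by (rule pairing_flip) (simp add: reflect_eq_flip flip_inner)

lemma C_weak_reflect:
  assumes "axis_accessible D" "u \<in> C_weak D T"
  shows "(\<lambda>t. reflect (u t)) \<in> C_weak (flip ` D) T"
proof -
  have "reflect \<phi> \<in> L2 D" if "\<phi> \<in> L2 (flip ` D)" for \<phi>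
    using L2_reflect[OF that] by simp
  with assms show ?thesis
    by (auto simp: C_weak_def pairing_reflect_left intro: H_sigma_reflect)
qed

lemma test_fields_reflect:
  assumes "axis_accessible D" "0 < T" "\<psi> \<in> test_fields D T"
  shows "(\<lambda>t. reflect (\<psi> t)) \<in> test_fields (flip ` D) T"
proof -
  \<comment> \<open>Test fields are smooth jointly in time and space, so the conjugation takes place
    on the product: \<open>M\<close> fixes time and flips space.\<close>
  define M :: "real \<times> (real^3) \<Rightarrow> real \<times> (real^3)" where "M = (\<lambda>(t, x). (t, flip x))"
  have M: "bounded_linear M"
    unfolding M_def case_prod_beta
    by (intro bounded_linear_Pair bounded_linear_fst
        bounded_linear_compose[OF bounded_linear_flip] bounded_linear_snd)
  have inv: "M (M z) = z" for z by (simp add: M_def case_prod_beta)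
  have Basis: "M b = (M b \<bullet> b) *\<^sub>R b" if "b \<in> Basis" for b
    using that
    by (auto simp: Basis_prod_def M_def linear_0[OF linear_flip] simp flip: flip_Basis)
  have image: "M ` ({0..T} \<times> D) = {0..T} \<times> flip ` D"
    by (auto simp: M_def image_def)
  have acc: "axis_accessible (M ` ({0..T} \<times> D))"
    unfolding image using assms
    by (intro axis_accessible_Times axis_accessible_Icc axis_accessible_flip)
  have "C_infinity_on ({0..T} \<times> D) (\<lambda>(t, x). \<psi> t x)"
    using assms by (simp add: test_fields_def)
  from C_infinity_on_conj[OF bounded_linear_flip M inv Basis acc this]
  have "C_infinity_on ({0..T} \<times> flip ` D) (\<lambda>(t, x). reflect (\<psi> t) x)"
    by (simp add: image) (simp add: M_def case_prod_beta' reflect_eq_flip)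
  with assms show ?thesis
    by (auto simp: test_fields_def intro: schwartz_sigma_on_reflect)
qed

lemma test_fields_time_derivative:
  assumes "0 < T" "\<psi> \<in> test_fields D T" "\<tau> \<in> {0..T}" "x \<in> D"
  shows "vector_derivative (\<lambda>s. reflect (\<psi> s) (flip x)) (at \<tau> within {0..T})
       = flip (vector_derivative (\<lambda>s. \<psi> s x) (at \<tau> within {0..T}))"
proof -
  let ?f = "\<lambda>(t, x). \<psi> t x"
  have "?f differentiable (at (\<tau>, x) within {0..T} \<times> D)"
    using assms by (intro C_infinity_on_imp_differentiable) (auto simp: test_fields_def)
  then obtain f' where "(?f has_derivative f') (at (\<tau>, x) within {0..T} \<times> D)"
    by (auto simp: differentiable_def)
  \<comment> \<open>Restricting the joint derivative to the time line through \<open>x\<close>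
    yields differentiability in time, without which \<open>vector_derivative\<close> would be an
    arbitrary choice.\<close>
  then have "(?f has_derivative f') (at (\<tau>, x) within (\<lambda>s. (s, x)) ` {0..T})"
    by (rule has_derivative_subset) (use assms in auto)
  then have "((\<lambda>s. ?f (s, x)) has_derivative (\<lambda>h. f' (h, 0))) (at \<tau> within {0..T})"
    by (rule has_derivative_in_compose[rotated]) (auto intro!: derivative_eq_intros)
  then have "(\<lambda>s. \<psi> s x) differentiable (at \<tau> within {0..T})"
    by (auto simp: differentiable_def)
  then have "((\<lambda>s. \<psi> s x) has_vector_derivative
      vector_derivative (\<lambda>s. \<psi> s x) (at \<tau> within {0..T})) (at \<tau> within {0..T})"
    by (simp add: vector_derivative_works)
  from bounded_linear.has_vector_derivative[OF bounded_linear_flip this]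
  show ?thesis
    using assms by (intro vector_derivative_within_closed_interval) (auto simp: reflect_eq_flip)
qed

text \<open>Boundary points are fixed by \<open>flip\<close>, so the reflection acts only on the
  value of the field and passes to \<open>n\<close> by self-adjointness.\<close>

lemma bdry_trace_reflect: "bdry_trace (\<lambda>t. reflect (\<phi> t)) n = bdry_trace \<phi> (flip n)"
proof -
  have "flip (vector [a, b, 0]) = vector [a, b, 0]" for a b
    by (simp add: vec_eq_iff forall_3)
  then show ?thesis by (simp add: bdry_trace_def fun_eq_iff reflect_eq_flip flip_inner)
qed

section \<open>Reflection of weak solutions\<close>

lemma euler_weak_solution_reflect:
  assumes D: "axis_accessible D" and T: "0 < T" and sol: "euler_weak_solution D n T u p"
  shows "euler_weak_solution (flip ` D) (flip n) T (\<lambda>t. reflect (u t)) p"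
  unfolding euler_weak_solution_def
proof (intro conjI ballI)
  show "(\<lambda>t. reflect (u t)) \<in> C_weak (flip ` D) T" "p \<in> bdry_distributions T"
    using sol C_weak_reflect[OF D] by (auto simp: euler_weak_solution_def)
next
  fix t \<phi>
  assume t: "t \<in> {0..T}" and \<phi>: "\<phi> \<in> test_fields (flip ` D) T"
  \<comment> \<open>The test field on \<open>D\<close> with which the original weak formulation is
    tested.\<close>
  define \<psi> where "\<psi> t = reflect (\<phi> t)" for t
  have \<phi>_eq: "\<phi> t = reflect (\<psi> t)" for t by (simp add: \<psi>_def)
  have \<psi>: "\<psi> \<in> test_fields D T"
    using test_fields_reflect[OF axis_accessible_flip[OF D] T \<phi>] by (simp add: \<psi>_def[abs_def])
  have diff: "\<psi> \<tau> differentiable (at x within D)" if "\<tau> \<in> {0..T}" "x \<in> D" for \<tau> x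
    using that \<psi> schwartz_sigma_on_subset schwartz_on_differentiable
    by (fastforce simp: test_fields_def)
  have trace: "bdry_trace \<psi> n = bdry_trace \<phi> (flip n)"
    unfolding \<psi>_def[abs_def] by (rule bdry_trace_reflect)
  have eq_values: "pairing (flip ` D) (reflect (u \<tau>)) (\<phi> \<tau>) = pairing D (u \<tau>) (\<psi> \<tau>)" for \<tau>
    by (simp add: pairing_reflect_left \<psi>_def)
  have eq_time: "pairing (flip ` D) (reflect (u \<tau>))
        (\<lambda>x. vector_derivative (\<lambda>s. \<phi> s x) (at \<tau> within {0..T}))
      = pairing D (u \<tau>) (\<lambda>x. vector_derivative (\<lambda>s. \<psi> s x) (at \<tau> within {0..T}))"
    if "\<tau> \<in> {0..T}" for \<tau>
    using test_fields_time_derivative[OF T \<psi> that]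
    by (intro pairing_flip) (simp add: \<phi>_eq reflect_eq_flip)
  have eq_convection: "pairing (flip ` D) (\<lambda>x. \<chi> i j. reflect (u \<tau>) x $ i * reflect (u \<tau>) x $ j)
        (grad_on (flip ` D) (\<phi> \<tau>))
      = pairing D (\<lambda>x. \<chi> i j. u \<tau> x $ i * u \<tau> x $ j) (grad_on D (\<psi> \<tau>))"
    if "\<tau> \<in> {0..T}" for \<tau>
    \<comment> \<open>With \<open>w\<close> the velocity and A the gradient at a point, the
      reflected integrand is R w . (R A R)(R w), which equals w . A w.\<close>
    unfolding \<phi>_eq
    by (rule pairing_flip)
       (simp add: dyad_inner grad_on_reflect[OF D _ diff[OF that]] reflect_eq_flip)
  \<comment> \<open>Only times in \<open>{0..t}\<close>, hence in \<open>{0..T}\<close>, enter the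
    integrals; the identities for the two integrands are available just for those.\<close>
  have ints: "(LINT \<tau>:{0..t}|lebesgue. F \<tau>) = (LINT \<tau>:{0..t}|lebesgue. G \<tau>)"
    if "\<And>\<tau>. \<tau> \<in> {0..T} \<Longrightarrow> F \<tau> = G \<tau>" for F G :: "real \<Rightarrow> real"
    unfolding set_lebesgue_integral_def using that t
    by (intro Bochner_Integration.integral_cong) (auto split: split_indicator)
  from sol t \<psi> obtain P where "has_bdry_pairing p t (bdry_trace \<psi> n) P"
    "pairing D (u t) (\<psi> t) - pairing D (u 0) (\<psi> 0)
          - (LINT \<tau>:{0..t}|lebesgue.
               pairing D (u \<tau>) (\<lambda>x. vector_derivative (\<lambda>s. \<psi> s x) (at \<tau> within {0..T})))
        = (LINT \<tau>:{0..t}|lebesgue.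
               pairing D (\<lambda>x. \<chi> i j. u \<tau> x $ i * u \<tau> x $ j) (grad_on D (\<psi> \<tau>)))
          - P"
    unfolding euler_weak_solution_def by blast
  \<comment> \<open>The same \<open>P\<close> serves on both sides, because the two boundary traces
    are equal as functions.\<close>
  then show "\<exists>P. has_bdry_pairing p t (bdry_trace \<phi> (flip n)) P \<and>
        pairing (flip ` D) (reflect (u t)) (\<phi> t) - pairing (flip ` D) (reflect (u 0)) (\<phi> 0)
          - (LINT \<tau>:{0..t}|lebesgue. pairing (flip ` D) (reflect (u \<tau>))
               (\<lambda>x. vector_derivative (\<lambda>s. \<phi> s x) (at \<tau> within {0..T})))
        = (LINT \<tau>:{0..t}|lebesgue.
               pairing (flip ` D) (\<lambda>x. \<chi> i j. reflect (u \<tau>) x $ i * reflect (u \<tau>) x $ j)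
                 (grad_on (flip ` D) (\<phi> \<tau>)))
          - P"
    by (intro exI[of _ P]) (simp only: trace eq_values ints[OF eq_time] ints[OF eq_convection])
qed

theorem theorem13:
  fixes T :: real
    and u :: "real \<Rightarrow> real^3 \<Rightarrow> real^3"
    and p :: "(real \<Rightarrow> real^2 \<Rightarrow> real) \<Rightarrow> real"
  assumes "0 < T"
    and "euler_weak_solution D_plus n_plus T u p"
  shows "euler_weak_solution D_minus n_minus T (\<lambda>t. reflect (u t)) p"
  using euler_weak_solution_reflect[OF axis_accessible_D_plus assms]
  by (simp add: flip_D_plus flip_n_plus)

end
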